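(* For $\alpha=0$ and $n=3$, the two-stage facility location game has no $\rho$-approximate pure subgame perfect equilibrium ($\rho$-SPE) with $\rho<\frac14\left(1+\sqrt{17}\right)$.
   Context: The game with parameters $n\ge 1$ and $\alpha\in[0,1]$: there are $n$ facility players $\{1,\dots,n\}$, each choosing a location $s_i\in[0,1]$; a facility location vector is $\mathsf{s}=(s_1,\dots,s_n)\in[0,1]^n$, and $(\mathsf{s}_{-i},s_i')$ is $\mathsf{s}$ with $s_i$ replaced by $s_i'$. The clients are the points $z\in[0,1]$. A client mapping is a function $\mathsf{f}:[0,1]^n\times[0,1]\to\{1,\dots,n\}$; client $z$ uses facility $\mathsf{f}(\mathsf{s},z)$. Only measurable mappings are considered: for every $\mathsf{s}$ and $i$, the set $\{z:\mathsf{f}(\mathsf{s},z)=i\}$ is a finite union of disjoint intervals; its total length is the load $\ell_i(\mathsf{s},\mathsf{f})$. The cost of client $z$ is $C_z(\mathsf{s},\mathsf{f})=(1-\alpha)|s_{\mathsf{f}(\mathsf{s},z)}-z|+\alpha\,\ell_{\mathsf{f}(\mathsf{s},z)}(\mathsf{s},\mathsf{f})$ (so for $\alpha=0$ it is just the distance). The utility of facility $i$ is $u_i(\mathsf{s},\mathsf{f})=\ell_i(\mathsf{s},\mathsf{f})$. A pair $(\mathsf{s},\mathsf{f})$ is a $\rho$-SPE if (1) for all $i$ and all $s_i'\in[0,1]$, $\rho\cdot u_i(\mathsf{s},\mathsf{f})\ge u_i((\mathsf{s}_{-i},s_i'),\mathsf{f})$; and (2) for every location vector $\mathsf{t}\in[0,1]^n$,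 $\mathsf{f}(\mathsf{t},\cdot)$ is a client equilibrium, i.e. for all $z\in[0,1]$ and all $j$, $(1-\alpha)|t_{\mathsf{f}(\mathsf{t},z)}-z|+\alpha\ell_{\mathsf{f}(\mathsf{t},z)}(\mathsf{t},\mathsf{f})\le(1-\alpha)|t_j-z|+\alpha\ell_j(\mathsf{t},\mathsf{f})$. *)

theory Defs
  imports "HOL-Analysis.Analysis"
begin

text \<open>
  Location vectors in \<open>[0,1]\<^sup>n\<close> are extensional functions on \<open>{1..n}\<close>, so that a client
  mapping depends on nothing but the \<open>n\<close> chosen locations.
\<close>

definition location_vectors :: "nat \<Rightarrow> (nat \<Rightarrow> real) set" where
  "location_vectors n = {1..n} \<rightarrow>\<^sub>E {0..1}"

type_synonym mapping = "(nat \<Rightarrow> real) \<Rightarrow> real \<Rightarrow> nat"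

definition clients_of :: "(nat \<Rightarrow> real) \<Rightarrow> mapping \<Rightarrow> nat \<Rightarrow> real set" where
  "clients_of s f i = {z \<in> {0..1}. f s z = i}"

text \<open>Intervals may be open, closed, half-open, degenerate or empty.\<close>

definition finite_interval_union :: "real set \<Rightarrow> bool" where
  "finite_interval_union A \<longleftrightarrow>
     (\<exists>\<I>. finite \<I> \<and> disjoint \<I> \<and> (\<forall>I\<in>\<I>. is_interval I) \<and> \<Union>\<I> = A)"

definition measurable_client_mapping :: "nat \<Rightarrow> mapping \<Rightarrow> bool" where
  "measurable_client_mapping n f \<longleftrightarrow>
     (\<forall>s \<in> location_vectors n.
        (\<forall>z \<in> {0..1}. f s z \<in> {1..n}) \<and>
        (\<forall>i \<in> {1..n}. finite_interval_union (clients_of s f i)))"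

definition load :: "(nat \<Rightarrow> real) \<Rightarrow> mapping \<Rightarrow> nat \<Rightarrow> real" where
  "load s f i = measure lborel (clients_of s f i)"

text \<open>
  The cost of client \<open>z\<close> at facility \<open>j\<close>, given the loads induced by \<open>f\<close>: clients are
  infinitesimal, so a single client switching to \<open>j\<close> does not change the load of \<open>j\<close>.
\<close>

definition cost_at :: "real \<Rightarrow> (nat \<Rightarrow> real) \<Rightarrow> mapping \<Rightarrow> real \<Rightarrow> nat \<Rightarrow> real" where
  "cost_at \<alpha> s f z j = (1 - \<alpha>) * \<bar>s j - z\<bar> + \<alpha> * load s f j"

definition client_cost :: "real \<Rightarrow> (nat \<Rightarrow> real) \<Rightarrow> mapping \<Rightarrow> real \<Rightarrow> real" where
  "client_cost \<alpha> s f z = cost_at \<alpha> s f z (f s z)"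

definition utility :: "(nat \<Rightarrow> real) \<Rightarrow> mapping \<Rightarrow> nat \<Rightarrow> real" where
  "utility s f i = load s f i"

definition client_equilibrium :: "nat \<Rightarrow> real \<Rightarrow> (nat \<Rightarrow> real) \<Rightarrow> mapping \<Rightarrow> bool" where
  "client_equilibrium n \<alpha> s f \<longleftrightarrow>
     (\<forall>z \<in> {0..1}. \<forall>j \<in> {1..n}. client_cost \<alpha> s f z \<le> cost_at \<alpha> s f z j)"

definition approx_SPE :: "nat \<Rightarrow> real \<Rightarrow> real \<Rightarrow> (nat \<Rightarrow> real) \<Rightarrow> mapping \<Rightarrow> bool" where
  "approx_SPE n \<alpha> \<rho> s f \<longleftrightarrow>
     s \<in> location_vectors n \<and> measurable_client_mapping n f \<and>
     (\<forall>i \<in> {1..n}. \<forall>x \<in> {0..1}. \<rho> * utility s f i \<ge> utility (s(i := x)) f i) \<and>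
     (\<forall>t \<in> location_vectors n. client_equilibrium n \<alpha> t f)"

end

theory Submission
  imports Defs
begin

text \<open>
  A facility can move next to another one, so with the others at \<open>l \<le> r\<close> it can secure a load
  arbitrarily close to each of \<open>l\<close> and \<open>1 - r\<close>. If the locations \<open>x < y < z\<close> are distinct and \<open>m\<close>
  is the load of the middle facility, the outer facilities' deviations towards \<open>y\<close> give
  \<open>1 \<le> \<rho> (1 - m)\<close>, and the middle one's deviations outwards give \<open>1 \<le> 2 (\<rho> + 1) m\<close>; together
  \<open>2 \<rho>\<^sup>2 - \<rho> - 2 \<ge> 0\<close>. If two or more facilities coincide, the one with the smallest load among
  them gains a factor of more than \<open>1.3 > (1 + sqrt 17) / 4\<close>, or the remaining one does.
\<close>

lemma finite_interval_union_borel: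
  assumes "finite_interval_union A"
  shows "A \<in> sets borel"
proof -
  obtain \<I> where I: "finite \<I>" "\<And>I. I \<in> \<I> \<Longrightarrow> is_interval I" "\<Union>\<I> = A"
    using assms unfolding finite_interval_union_def by blast
  have "\<Union>\<I> \<in> sets borel"
    using I by (intro sets.finite_Union) (auto intro: real_interval_borel_measurable)
  then show ?thesis using I by simp
qed

lemma clients_of_fmeasurable:
  assumes "measurable_client_mapping n f" "t \<in> location_vectors n" "i \<in> {1..n}"
  shows "clients_of t f i \<in> fmeasurable lborel"
proof (rule fmeasurableI2)
  show "{0..1::real} \<in> fmeasurable lborel" by (intro fmeasurableI) auto
  show "clients_of t f i \<subseteq> {0..1}" by (auto simp: clients_of_def)
  show "clients_of t f i \<in> sets lborel"
    using assms finite_interval_union_borel by (auto simp: measurable_client_mapping_def)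
qed

text \<open>For \<alpha> = 0 a client's cost is its distance, so an equilibrium sends every client
  strictly closest to \<open>i\<close> to \<open>i\<close>. Endpoints of \<open>{a<..<b}\<close>,
  where ties may occur, do not affect the measure.\<close>

lemma load_ge:
  assumes f: "measurable_client_mapping n f" and t: "t \<in> location_vectors n"
    and eq: "client_equilibrium n 0 t f" and i: "i \<in> {1..n}"
    and ab: "0 \<le> a" "a \<le> b" "b \<le> 1"
    and near: "\<And>z j. \<lbrakk>a < z; z < b; j \<in> {1..n}; j \<noteq> i\<rbrakk> \<Longrightarrow> \<bar>t i - z\<bar> < \<bar>t j - z\<bar>"
  shows "b - a \<le> load t f i"
proof -
  have "f t z = i" if z: "a < z" "z < b" for z
  proof (rule ccontr)
    assume "f t z \<noteq> i"
    moreover have z01: "z \<in> {0..1}" using z ab by auto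
    moreover have "f t z \<in> {1..n}" using f t z01 unfolding measurable_client_mapping_def by blast
    ultimately have "\<bar>t i - z\<bar> < \<bar>t (f t z) - z\<bar>" using near z by blast
    moreover have "\<bar>t (f t z) - z\<bar> \<le> \<bar>t i - z\<bar>"
      using eq i z01 by (simp add: client_equilibrium_def client_cost_def cost_at_def)
    ultimately show False by simp
  qed
  then have "{a<..<b} \<subseteq> clients_of t f i"
    using ab by (auto simp: clients_of_def)
  then have "measure lborel {a<..<b} \<le> load t f i"
    unfolding load_def using clients_of_fmeasurable[OF f t i]
    by (intro measure_mono_fmeasurable) auto
  then show ?thesis using ab by simp
qed

text \<open>A client of \<open>j\<close> has \<open>j\<close> among its nearest facilities, and
  client sets are disjoint. A set \<open>J\<close> is needed because \<open>f\<close> splits the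
  clients of coincident facilities arbitrarily; only their joint load is controlled.\<close>

lemma sum_load_le:
  assumes f: "measurable_client_mapping n f" and t: "t \<in> location_vectors n"
    and eq: "client_equilibrium n 0 t f" and J: "J \<subseteq> {1..n}" and ab: "a \<le> b"
    and near: "\<And>z j. \<lbrakk>0 \<le> z; z \<le> 1; j \<in> J; \<And>k. k \<in> {1..n} \<Longrightarrow> \<bar>t j - z\<bar> \<le> \<bar>t k - z\<bar>\<rbrakk>
                \<Longrightarrow> a \<le> z \<and> z \<le> b"
  shows "(\<Sum>j\<in>J. load t f j) \<le> b - a"
proof -
  have meas: "clients_of t f j \<in> fmeasurable lborel" if "j \<in> J" for j
    using clients_of_fmeasurable[OF f t] J that by auto
  have fin: "finite J" using J by (rule finite_subset) simp
  have "(\<Sum>j\<in>J. load t f j) = measure lborel (\<Union>j\<in>J. clients_of t f j)"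
    unfolding load_def using meas fin
    by (intro measure_finite_Union[symmetric])
       (auto simp: disjoint_family_on_def clients_of_def fmeasurable_def less_top)
  also have "\<dots> \<le> measure lborel {a..b}"
  proof (rule measure_mono_fmeasurable)
    show "(\<Union>j\<in>J. clients_of t f j) \<subseteq> {a..b}"
    proof
      fix z assume "z \<in> (\<Union>j\<in>J. clients_of t f j)"
      then obtain j where j: "j \<in> J" "0 \<le> z" "z \<le> 1" "f t z = j"
        by (auto simp: clients_of_def)
      then have "\<bar>t j - z\<bar> \<le> \<bar>t k - z\<bar>" if "k \<in> {1..n}" for k
        using eq that by (force simp: client_equilibrium_def client_cost_def cost_at_def)
      then show "z \<in> {a..b}" using near[of z j] j by auto
    qed
    show "(\<Union>j\<in>J. clients_of t f j) \<in> sets lborel"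
      using meas[THEN fmeasurableD] fin by (intro sets.finite_UN)
  qed (intro fmeasurableI; simp add: emeasure_lborel_Icc_eq)
  finally show ?thesis using ab by simp
qed

text \<open>Facility \<open>i\<close> moves to just left of \<open>s j\<close> or just right of
  \<open>s k\<close> and wins all clients beyond its new location. The set equation lets
  \<open>i, j, k\<close> be any permutation of the players.\<close>

lemma approx_SPE_deviation:
  assumes spe: "approx_SPE 3 0 \<rho> s f" and ijk: "{i, j, k} = {1, 2, 3::nat}"
    and jk: "s j \<le> s k"
  shows "s j \<le> \<rho> * load s f i" "1 - s k \<le> \<rho> * load s f i"
proof -
  have f: "measurable_client_mapping 3 f" and s: "s \<in> location_vectors 3"
    using spe by (auto simp: approx_SPE_def)
  have all: "{1..3} = {i, j, k}" unfolding ijk by auto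
  have "card {i, j, k} = 3" unfolding ijk by simp
  then have ne: "j \<noteq> i" "k \<noteq> i" by (auto simp: card_insert_if split: if_splits)
  have dev: "b - a \<le> \<rho> * load s f i"
    if x: "0 \<le> x" "x \<le> 1" and ab: "0 \<le> a" "a \<le> b" "b \<le> 1"
      and near: "\<And>z. a < z \<Longrightarrow> z < b \<Longrightarrow> \<bar>x - z\<bar> < \<bar>s j - z\<bar> \<and> \<bar>x - z\<bar> < \<bar>s k - z\<bar>"
    for x a b
  proof -
    have t: "s(i := x) \<in> location_vectors 3"
      using s x all by (auto simp: location_vectors_def PiE_iff extensional_def)
    have "b - a \<le> load (s(i := x)) f i"
      using near ne ab spe t by (intro load_ge[OF f t, unfolded all]) (auto simp: approx_SPE_def)
    also have "\<dots> \<le> \<rho> * load s f i"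
      using spe x all by (auto simp: approx_SPE_def utility_def)
    finally show ?thesis .
  qed
  have loc: "0 \<le> s j" "s k \<le> 1"
    using s all by (auto simp: location_vectors_def PiE_iff)
  \<comment> \<open>The degenerate interval covers the negative \<open>e\<close> in the limits
    below, which are not admissible locations.\<close>
  have nonneg: "0 \<le> \<rho> * load s f i" using dev[of 0 0 0] by simp
  \<comment> \<open>Moving exactly to \<open>s j\<close> would create ties that \<open>f\<close> may
    break against \<open>i\<close>; hence a limit from below.\<close>
  show "s j \<le> \<rho> * load s f i"
  proof (rule dense_le)
    fix e assume e: "e < s j"
    show "e \<le> \<rho> * load s f i"
    proof (cases "0 \<le> e")
      case True
      then show ?thesis using dev[of e 0 e] e jk loc by auto
    qed (use nonneg in auto)
  qed
  show "1 - s k \<le> \<rho> * load s f i"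
  proof (rule dense_le)
    fix e assume e: "e < 1 - s k"
    show "e \<le> \<rho> * load s f i"
    proof (cases "0 \<le> e")
      case True
      then show ?thesis using dev[of "1 - e" "1 - e" 1] e jk loc by auto
    qed (use nonneg in auto)
  qed
qed

text \<open>\<open>quad\<close> refutes distinct locations. The rational bound 13/10 refutes
  coincident ones, which fail for every factor below 4/3.\<close>

lemma not_approx_SPE_sorted:
  assumes c1: "1 \<le> c" and c13: "c \<le> 13 / 10" and quad: "2 * c\<^sup>2 < c + 2"
    and ijk: "{i, j, k} = {1, 2, 3::nat}" and sorted: "s i \<le> s j" "s j \<le> s k"
  shows "\<not> approx_SPE 3 0 c s f"
proof
  assume spe: "approx_SPE 3 0 c s f"
  have f: "measurable_client_mapping 3 f" and s: "s \<in> location_vectors 3"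
    and eq: "client_equilibrium 3 0 s f"
    using spe by (auto simp: approx_SPE_def)
  have all: "{1..3} = {i, j, k}" unfolding ijk by auto
  have "card {i, j, k} = 3" unfolding ijk by simp
  then have ne: "i \<noteq> j" "i \<noteq> k" "j \<noteq> k" by (auto simp: card_insert_if split: if_splits)
  have loc: "0 \<le> s i" "s k \<le> 1"
    using s all by (auto simp: location_vectors_def PiE_iff)
  have le: "(\<Sum>l\<in>J. load s f l) \<le> b - a"
    if "J \<subseteq> {i, j, k}" "a \<le> b"
      and "\<And>z l. \<lbrakk>0 \<le> z; z \<le> 1; l \<in> J; \<bar>s l - z\<bar> \<le> \<bar>s i - z\<bar>; \<bar>s l - z\<bar> \<le> \<bar>s j - z\<bar>;
              \<bar>s l - z\<bar> \<le> \<bar>s k - z\<bar>\<rbrakk> \<Longrightarrow> a \<le> z \<and> z \<le> b" for J a b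
    using that by (intro sum_load_le[OF f s eq, unfolded all]) auto
  have nonneg: "0 \<le> load s f l" for l by (simp add: load_def)
  have bound: "c * load s f l \<le> 13 / 10 * load s f l" for l
    using c13 nonneg by (intro mult_right_mono)
  have dev_i: "s j \<le> c * load s f i" "1 - s k \<le> c * load s f i"
    using approx_SPE_deviation[OF spe, of i j k] ijk sorted by auto
  have dev_j: "s i \<le> c * load s f j" "1 - s k \<le> c * load s f j"
    using approx_SPE_deviation[OF spe, of j i k] ijk sorted by (auto simp: insert_commute)
  have dev_k: "s i \<le> c * load s f k" "1 - s j \<le> c * load s f k"
    using approx_SPE_deviation[OF spe, of k i j] ijk sorted by (auto simp: insert_commute)
  \<comment> \<open>A numeral in place of \<open>c\<close> makes the constraints linear in locations
    and loads.\<close>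
  have load_bounds: "s j \<le> 13 / 10 * load s f i" "1 - s k \<le> 13 / 10 * load s f i"
    "s i \<le> 13 / 10 * load s f j" "1 - s k \<le> 13 / 10 * load s f j"
    "s i \<le> 13 / 10 * load s f k" "1 - s j \<le> 13 / 10 * load s f k"
    using dev_i dev_j dev_k bound order_trans by blast+
  consider "s i < s j" "s j < s k" | "s i = s j" "s j < s k" | "s i < s j" "s j = s k"
    | "s i = s j" "s j = s k" using sorted by linarith
  then show False
  proof cases
    case 1
    \<comment> \<open>The distance between the midpoints on either side of
      \<open>s j\<close>.\<close>
    define m where "m = (s k - s i) / 2"
    have "(\<Sum>l\<in>{i}. load s f l) \<le> (s i + s j) / 2 - 0"
      by (rule le) (use 1 loc in \<open>auto simp: abs_if split: if_splits\<close>)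
    then have "load s f i \<le> (s i + s j) / 2" by simp
    then have i: "s j \<le> c * ((s i + s j) / 2)"
      using dev_i c1 by (smt (verit) mult_left_mono)
    have "(\<Sum>l\<in>{k}. load s f l) \<le> 1 - (s j + s k) / 2"
      by (rule le) (use 1 loc in \<open>auto simp: abs_if split: if_splits\<close>)
    then have "load s f k \<le> 1 - (s j + s k) / 2" by simp
    then have k: "1 - s j \<le> c * (1 - (s j + s k) / 2)"
      using dev_k c1 by (smt (verit) mult_left_mono)
    have "(\<Sum>l\<in>{j}. load s f l) \<le> (s j + s k) / 2 - (s i + s j) / 2"
      by (rule le) (use 1 loc in \<open>auto simp: abs_if split: if_splits\<close>)
    then have "load s f j \<le> (s j + s k) / 2 - (s i + s j) / 2" by simp
    then have "load s f j \<le> m" by (simp add: m_def field_simps)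
    then have "c * load s f j \<le> c * m" using c1 by simp
    then have m: "1 \<le> 2 * (c + 1) * m"
      using dev_j by (simp add: m_def field_simps)
    have "1 \<le> c * (1 - m)" using i k by (simp add: m_def field_simps)
    then have "c * m \<le> c - 1" by (simp add: algebra_simps)
    \<comment> \<open>Eliminating \<open>m\<close> yields
      \<open>c \<le> 2 * (c + 1) * (c - 1)\<close>, against \<open>quad\<close>.\<close>
    then have "2 * (c + 1) * (c * m) \<le> 2 * (c + 1) * (c - 1)"
      using c1 by (intro mult_left_mono) auto
    moreover have "c * 1 \<le> c * (2 * (c + 1) * m)"
      using m c1 by (intro mult_left_mono) auto
    ultimately show False using quad by (simp add: algebra_simps power2_eq_square)
  next
    case 2
    \<comment> \<open>The pair shares the clients up to the midpoint, yet each member can secure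
      both \<open>s i\<close> and \<open>1 - s k\<close>; this clashes with the demand
      \<open>1 - s j\<close> of \<open>k\<close>.\<close>
    have "(\<Sum>l\<in>{i, j}. load s f l) \<le> (s i + s k) / 2 - 0"
      by (rule le) (use 2 loc in \<open>auto simp: abs_if split: if_splits\<close>)
    then have "load s f i + load s f j \<le> (s i + s k) / 2" using ne by simp
    moreover have "load s f k \<le> 1 - (s j + s k) / 2"
    proof -
      have "(\<Sum>l\<in>{k}. load s f l) \<le> 1 - (s j + s k) / 2"
        by (rule le) (use 2 loc in \<open>auto simp: abs_if split: if_splits\<close>)
      then show ?thesis by simp
    qed
    ultimately show False
      using load_bounds 2 by argo
  next
    case 3
    \<comment> \<open>Mirror image of the previous case.\<close>
    have "(\<Sum>l\<in>{j, k}. load s f l) \<le> 1 - (s i + s j) / 2"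
      by (rule le) (use 3 loc in \<open>auto simp: abs_if split: if_splits\<close>)
    then have "load s f j + load s f k \<le> 1 - (s i + s j) / 2" using ne by simp
    moreover have "load s f i \<le> (s i + s j) / 2"
    proof -
      have "(\<Sum>l\<in>{i}. load s f l) \<le> (s i + s j) / 2 - 0"
        by (rule le) (use 3 loc in \<open>auto simp: abs_if split: if_splits\<close>)
      then show ?thesis by simp
    qed
    ultimately show False
      using load_bounds 3 by argo
  next
    case 4
    \<comment> \<open>Each facility can secure the larger side, at least 1/2, so the factor would be
      at least 3/2.\<close>
    have "load s f i + load s f j + load s f k \<le> 1"
      using le[of "{i, j, k}" 0 1] ne by simp
    then show False
      using load_bounds 4 by linarith
  qed
qed

lemma approx_SPE_mono:
  assumes "approx_SPE n \<alpha> \<rho> s f" "\<rho> \<le> c"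
  shows "approx_SPE n \<alpha> c s f"
proof -
  have "\<rho> * utility s f i \<le> c * utility s f i" for i
    using assms by (intro mult_right_mono) (auto simp: utility_def load_def)
  then show ?thesis
    using assms unfolding approx_SPE_def by (meson order_trans)
qed

theorem theorem2:
  fixes \<rho> :: real
  assumes "\<rho> < 1 / 4 * (1 + sqrt 17)"
  shows "\<not> (\<exists>s f. approx_SPE 3 0 \<rho> s f)"
proof
  assume "\<exists>s f. approx_SPE 3 0 \<rho> s f"
  then obtain s f where spe: "approx_SPE 3 0 \<rho> s f" by blast
  \<comment> \<open>Enlarging the factor keeps an SPE, and \<open>1 \<le> c\<close> permits
    multiplying inequalities by \<open>c\<close> and squaring \<open>4 * c - 1\<close>.\<close>
  define c where "c = max \<rho> 1"
  \<comment> \<open>This is \<open>4 * c - 1 < sqrt 17\<close> at \<open>c = 1\<close>.\<close>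
  have "3 < sqrt 17" by (rule real_less_rsqrt) simp
  then have c: "1 \<le> c" "4 * c - 1 < sqrt 17" using assms by (auto simp: c_def)
  have "(4 * c - 1)\<^sup>2 < (sqrt 17)\<^sup>2" using c by (intro power_strict_mono) auto
  then have quad: "2 * c\<^sup>2 < c + 2" by (simp add: power2_eq_square algebra_simps)
  \<comment> \<open>Chosen since (1 + 4.2) / 4 = 1.3.\<close>
  have "sqrt 17 < 42 / 10" by (rule real_less_lsqrt) (auto simp: power2_eq_square)
  then have c13: "c \<le> 13 / 10" using c by simp
  have spe_c: "approx_SPE 3 0 c s f" using spe by (rule approx_SPE_mono) (simp add: c_def)
  have "\<exists>i j k. {i, j, k} = {1, 2, 3::nat} \<and> s i \<le> s j \<and> s j \<le> s k"
  proof -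
    have perms: "{1, 3, 2} = {1, 2, 3::nat}" "{2, 1, 3} = {1, 2, 3::nat}"
      "{2, 3, 1} = {1, 2, 3::nat}" "{3, 1, 2} = {1, 2, 3::nat}" "{3, 2, 1} = {1, 2, 3::nat}"
      by auto
    show ?thesis
      using linear[of "s 1" "s 2"] linear[of "s 1" "s 3"] linear[of "s 2" "s 3"] perms by metis
  qed
  then show False using not_approx_SPE_sorted[OF c(1) c13 quad] spe_c by blast
qed

end
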